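(* Let $X\ge 1$, $y\ge 2$ and $f(y)>0$ be real numbers, and write $u=\frac{\log x}{\log y}$. If $$|\Delta(x,y)| \le x f(y) \rho(u) \quad \text{for all } 1\le x \le X,$$ then $$|R^*(x,y)| \le x f(y) \quad \text{for all } 1\le x \le X$$ and $$|Q^*(x,y)| \le x f(y) \Pi(y)^{-1} \quad \text{for all } 1\le x \le X.$$
   Context: Notation. $\{x\}$ is the fractional part of $x$; $p$ denotes primes; $1_{x\ge1}$ equals $1$ if $x\ge 1$ and $0$ otherwise. Throughout $u=\log x/\log y$. $\rho$ is Dickman's function: $\rho(u)=0$ for $u<0$, $\rho(u)=1$ for $0\le u\le 1$, $\rho$ is continuous on $[0,\infty)$ and $u\rho'(u)=-\rho(u-1)$ for $u>1$; $\rho'(u)$ is defined by right-continuity at $u=0,1$ (so $\rho'(0)=0$, $\rho'(1)=-1$). $\omega$ is Buchstab's function: $\omega(u)=0$ for $u<1$, $\omega(u)=1/u$ for $1\le u\le 2$, $\omega$ is continuous on $[1,\infty)$ and $(u\omega(u))'=\omega(u-1)$ for $u>2$. $\mathcal S_y$ is the set of positive integers all of whose prime factors are $\le y$ (so $1\in\mathcal S_y$). $\Psi(x,y)=|\mathcal S_y\cap[1,x]|$. $\Phi(x,y)$ is the number of integers $1\le n\le x$ all of whose prime factors are $>y$ (including $n=1$). $\Pi(y)=\prod_{p\le y}(1-1/p)$. $\mu_y(u)=\int_0^u \omega(u-v)y^{-v}\,dv$ (so $\mu_y(u)=0$ for $u<1$, including $u<0$). For $x\ge1$, $y\ge2$: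 $$\Lambda(x,y)= x \rho(u)-\{x\}-x\int_0^u \rho'(u-v) \frac{\{y^v\}}{y^v}\, dv,\qquad \Delta(x,y)=\Psi(x,y)-\Lambda(x,y).$$ For $x>0$, $y\ge 2$: $$V^*(x,y)=1_{x\ge 1} + x \mu_y(u),\qquad Q^*(x,y)=V^*(x,y)-\Phi(x,y),\qquad R^*(x,y)=\sum_{n\in\mathcal S_y}Q^*(x/n,y).$$ *)

theory Defs
  imports "HOL-Analysis.Analysis" "HOL-Computational_Algebra.Primes"
begin

lemma delay_equation_unique:
  fixes F G :: "real \<Rightarrow> real"
  assumes eq: "\<And>u. u \<le> 1 \<Longrightarrow> F u = G u"
    and contF: "continuous_on {1..} F" and contG: "continuous_on {1..} G"
    and derF: "\<And>u. u > 1 \<Longrightarrow> (F has_real_derivative k u * F (u - 1)) (at u)"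
    and derG: "\<And>u. u > 1 \<Longrightarrow> (G has_real_derivative k u * G (u - 1)) (at u)"
  shows "F = G"
proof -
  have main: "\<forall>u \<le> real n + 1. F u = G u" for n
  proof (induction n)
    case 0
    then show ?case using eq by simp
  next
    case (Suc n)
    show ?case
    proof (intro allI impI)
      fix u assume u: "u \<le> real (Suc n) + 1"
      show "F u = G u"
      proof (cases "u \<le> 1")
        case True
        then show ?thesis by (rule eq)
      next
        case False
        have "(\<lambda>t. F t - G t) u = (\<lambda>t. F t - G t) 1"
        proof (rule DERIV_isconst2[of 1 u])
          show "1 < u" using False by simp
          show "continuous_on {1..u} (\<lambda>t. F t - G t)"
            by (intro continuous_on_diff continuous_on_subset[OF contF] continuous_on_subset[OF contG]) auto
          fix t assume t: "1 < t" "t < u"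
          have "F (t - 1) = G (t - 1)" using Suc t u by simp
          then show "((\<lambda>t. F t - G t) has_real_derivative 0) (at t)"
            using DERIV_diff[OF derF[OF t(1)] derG[OF t(1)]] by simp
        qed (use False in auto)
        then show ?thesis using eq[of 1] by simp
      qed
    qed
  qed
  show ?thesis
  proof
    fix u :: real
    obtain n where "u \<le> real n" using real_arch_simple by blast
    then show "F u = G u" using main[of n] by simp
  qed
qed

lemma delay_equation_ex:
  fixes k :: "real \<Rightarrow> real"
  assumes k: "continuous_on {1..} k"
  shows "\<exists>F. (\<forall>u\<le>1. F u = 1) \<and> continuous_on UNIV F \<and>
              (\<forall>u>1. (F has_real_derivative k u * F (u - 1)) (at u))"
proof -
  define G where "G n = ((\<lambda>g u. 1 + integral {1..u} (\<lambda>t. k t * g (t - 1))) ^^ n) (\<lambda>_. 1)" for n :: nat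
  have G0: "G 0 = (\<lambda>_. 1)" by (simp add: G_def)
  have GS: "G (Suc n) = (\<lambda>u. 1 + integral {1..u} (\<lambda>t. k t * G n (t - 1)))" for n
    by (simp add: G_def)
  have le1: "G n u = 1" if "u \<le> 1" for n u
  proof (cases n)
    case (Suc m)
    have "integral {1..u} (\<lambda>t. k t * G m (t - 1)) = 0"
      using that by (cases "u = 1") auto
    then show ?thesis by (simp add: Suc GS)
  qed (simp add: G0)
  have der: "(G (Suc n) has_real_derivative k u * G n (u - 1)) (at u within {1..})"
    if c: "continuous_on UNIV (G n)" and u: "u \<ge> 1" for n u
  proof -
    have "continuous_on {1..u+1} (\<lambda>t. k t * G n (t - 1))"
      by (intro continuous_intros continuous_on_subset[OF k]
          continuous_on_compose2[OF c]) auto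
    then have "((\<lambda>x. integral {1..x} (\<lambda>t. k t * G n (t - 1))) has_real_derivative k u * G n (u - 1))
                 (at u within {1..u+1})"
      by (rule integral_has_real_derivative) (use u in auto)
    then have "(G (Suc n) has_real_derivative k u * G n (u - 1)) (at u within {1..u+1})"
      unfolding GS by (auto intro!: derivative_eq_intros)
    moreover have "at u within {1..u+1} = at u within {1..}"
      by (rule at_within_nhd[where S = "{..<u+1}"]) auto
    ultimately show ?thesis by simp
  qed
  have cont: "continuous_on UNIV (G n)" for n
  proof (induction n)
    case 0
    then show ?case by (simp add: G0)
  next
    case (Suc n)
    have "continuous_on {1..} (G (Suc n))"
      by (rule DERIV_continuous_on) (use der[OF Suc] in auto)
    moreover have "continuous_on {..1} (G (Suc n))"
      using continuous_on_cong[of "{..1}" "{..1}" "G (Suc n)" "\<lambda>_. 1"] le1 by simp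
    ultimately have "continuous_on ({..1} \<union> {1..}) (G (Suc n))"
      by (intro continuous_on_closed_Un) auto
    moreover have "{..1} \<union> {1..} = (UNIV :: real set)" by auto
    ultimately show ?case by simp
  qed
  have step: "\<forall>u \<le> real n + 1. G (Suc n) u = G n u" for n
  proof (induction n)
    case 0
    then show ?case using le1 by simp
  next
    case (Suc n)
    show ?case
    proof (intro allI impI)
      fix u assume "u \<le> real (Suc n) + 1"
      then have "integral {1..u} (\<lambda>t. k t * G (Suc n) (t - 1)) = integral {1..u} (\<lambda>t. k t * G n (t - 1))"
        by (intro integral_cong) (use Suc in auto)
      then show "G (Suc (Suc n)) u = G (Suc n) u"
        by (subst GS, subst GS) simp
    qed
  qed
  have stab: "G (n + m) u = G n u" if "u \<le> real n + 1" for n m u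
  proof (induction m)
    case (Suc m)
    then show ?case using step[of "n + m"] that by simp
  qed simp
  define F where "F u = G (nat \<lceil>u\<rceil>) u" for u
  have F: "F u = G n u" if "u \<le> real n + 1" for n u
  proof (cases "nat \<lceil>u\<rceil> \<le> n")
    case True
    have "u \<le> real (nat \<lceil>u\<rceil>) + 1" by linarith
    then show ?thesis using stab[of u "nat \<lceil>u\<rceil>" "n - nat \<lceil>u\<rceil>"] True by (simp add: F_def)
  next
    case False
    then have "n + (nat \<lceil>u\<rceil> - n) = nat \<lceil>u\<rceil>" by linarith
    then show ?thesis using stab[of u n "nat \<lceil>u\<rceil> - n"] that by (simp add: F_def)
  qed
  have ev: "\<forall>\<^sub>F t in nhds u. F t = G n t" if "u < real n + 1" for n u
    using eventually_nhds_in_open[of "{..<real n + 1}" u] that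
    by (auto elim!: eventually_mono intro!: F)
  have "continuous_on UNIV F"
  proof (rule continuous_at_imp_continuous_on, rule ballI)
    fix u :: real
    obtain n where "u < real n" using reals_Archimedean2 by blast
    then have "u < real n + 1" by simp
    moreover have "isCont (G n) u"
      using cont[of n] by (simp add: continuous_on_eq_continuous_at)
    ultimately show "isCont F u" using isCont_cong[OF ev] by blast
  qed
  moreover have "(F has_real_derivative k u * F (u - 1)) (at u)" if "u > 1" for u
  proof -
    obtain n where n: "u < real n" using reals_Archimedean2 by blast
    have "at u within {1..} = at u"
      using that by (intro at_within_interior) (auto simp: interior_real_atLeast)
    then have "(G (Suc n) has_real_derivative k u * F (u - 1)) (at u)"
      using der[OF cont, of u n] that F[of "u - 1" n] n by simp
    moreover have "\<forall>\<^sub>F t in nhds u. F t = G (Suc n) t" using ev[of u "Suc n"] n by simp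
    ultimately show ?thesis using DERIV_cong_ev[of u u F "G (Suc n)"] by blast
  qed
  moreover have "F u = 1" if "u \<le> 1" for u
    using F[of u 0] le1 that by simp
  ultimately show ?thesis by blast
qed

definition is_dickman :: "(real \<Rightarrow> real) \<Rightarrow> bool" where
  "is_dickman r \<longleftrightarrow>
     (\<forall>u<0. r u = 0) \<and> (\<forall>u\<in>{0..1}. r u = 1) \<and> continuous_on {0..} r \<and>
     (\<forall>u>1. r differentiable (at u) \<and> u * deriv r u = - r (u - 1))"

definition dickman :: "real \<Rightarrow> real" where
  "dickman = (THE r. is_dickman r)"

definition dickman_deriv :: "real \<Rightarrow> real" where
  "dickman_deriv u =
     (if u = 0 \<or> u = 1 then Lim (at_right u) (deriv dickman) else deriv dickman u)"

lemma is_dickman_has_derivative: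
  assumes "is_dickman r" "u > 1"
  shows "(r has_real_derivative (- 1 / u) * r (u - 1)) (at u)"
proof -
  have "r differentiable (at u)" and eq: "u * deriv r u = - r (u - 1)"
    using assms by (auto simp: is_dickman_def)
  then have "(r has_real_derivative deriv r u) (at u)"
    by (simp add: DERIV_deriv_iff_real_differentiable)
  moreover have "deriv r u = (- 1 / u) * r (u - 1)"
    using eq assms(2) by (simp add: field_simps)
  ultimately show ?thesis by simp
qed

lemma dickman_ex1: "\<exists>!r. is_dickman r"
proof (rule ex_ex1I)
  have "continuous_on {1..} (\<lambda>u::real. - 1 / u)" by (intro continuous_intros) auto
  from delay_equation_ex[OF this] obtain F where
    F1: "\<And>u. u \<le> 1 \<Longrightarrow> F u = 1" and Fc: "continuous_on UNIV F" and
    Fd: "\<And>u. u > 1 \<Longrightarrow> (F has_real_derivative (- 1 / u) * F (u - 1)) (at u)"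
    by blast
  define r where "r u = (if u < 0 then 0 else F u)" for u
  have "continuous_on {0..} r"
    using continuous_on_cong[of "{0..}" "{0..}" r F] continuous_on_subset[OF Fc, of "{0..}"]
    by (simp add: r_def)
  moreover have "r differentiable (at u) \<and> u * deriv r u = - r (u - 1)" if u: "u > 1" for u
  proof -
    have "\<forall>\<^sub>F t in nhds u. r t = F t"
      using eventually_nhds_in_open[of "{0<..}" u] u
      by (auto elim!: eventually_mono simp: r_def)
    then have d: "(r has_real_derivative (- 1 / u) * r (u - 1)) (at u)"
      using DERIV_cong_ev[of u u r F] Fd[OF u] u by (simp add: r_def)
    then have "deriv r u = (- 1 / u) * r (u - 1)" by (rule DERIV_imp_deriv)
    with d u show ?thesis by (auto simp: real_differentiable_def)
  qed
  ultimately have "is_dickman r" by (auto simp: is_dickman_def r_def F1)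
  then show "\<exists>r. is_dickman r" by (rule exI[where P = is_dickman])
next
  fix r s assume r: "is_dickman r" and s: "is_dickman s"
  show "r = s"
  proof (rule delay_equation_unique[where k = "\<lambda>u. - 1 / u"])
    fix u :: real assume "u \<le> 1"
    then show "r u = s u" using r s by (cases "u < 0") (auto simp: is_dickman_def)
  next
    show "continuous_on {1..} r" "continuous_on {1..} s"
      using r s by (auto simp: is_dickman_def intro: continuous_on_subset)
  qed (use r s in \<open>auto dest: is_dickman_has_derivative\<close>)
qed

lemma is_dickman_dickman: "is_dickman dickman"
  unfolding dickman_def by (rule theI'[OF dickman_ex1])

lemma deriv_dickman_less_1:
  assumes "0 < u" "u < 1"
  shows "deriv dickman u = 0"
proof (rule DERIV_imp_deriv)
  have "\<forall>\<^sub>F t in nhds u. dickman t = 1"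
    using eventually_nhds_in_open[of "{0<..<1}" u] assms is_dickman_dickman
    by (auto elim!: eventually_mono simp: is_dickman_def)
  then show "(dickman has_real_derivative 0) (at u)"
    using DERIV_cong_ev[of u u dickman "\<lambda>_. 1"] by simp
qed

lemma dickman_deriv_less_1:
  assumes "0 \<le> u" "u < 1"
  shows "dickman_deriv u = 0"
proof (cases "u = 0")
  case True
  have "\<forall>\<^sub>F t in at_right 0. deriv dickman t = 0"
    using eventually_at_right_real[of 0 1, simplified] by eventually_elim (simp add: deriv_dickman_less_1)
  then have "(deriv dickman \<longlongrightarrow> 0) (at_right 0)" by (rule tendsto_eventually)
  then show ?thesis by (simp add: True dickman_deriv_def tendsto_Lim)
next
  case False
  with assms show ?thesis by (simp add: dickman_deriv_def deriv_dickman_less_1)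
qed

lemma dickman_deriv_ge_1:
  assumes "u \<ge> 1"
  shows "dickman_deriv u = - dickman (u - 1) / u"
proof -
  have d: "deriv dickman t = - dickman (t - 1) / t" if "t > 1" for t
    using is_dickman_dickman that by (auto simp: is_dickman_def field_simps)
  show ?thesis
  proof (cases "u = 1")
    case True
    have "\<forall>\<^sub>F t in at_right 1. - 1 / t = deriv dickman t"
      using eventually_at_right_real[of 1 2, simplified]
    proof eventually_elim
      case (elim t)
      then have "dickman (t - 1) = 1" using is_dickman_dickman by (auto simp: is_dickman_def)
      with elim show ?case by (simp add: d)
    qed
    moreover have "((\<lambda>t::real. - 1 / t) \<longlongrightarrow> - 1 / 1) (at_right 1)"
      by (intro tendsto_intros) auto
    ultimately have "(deriv dickman \<longlongrightarrow> - 1) (at_right 1)"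
      using Lim_transform_eventually by fastforce
    moreover have "dickman 0 = 1" using is_dickman_dickman by (auto simp: is_dickman_def)
    ultimately show ?thesis by (simp add: True dickman_deriv_def tendsto_Lim)
  next
    case False
    with assms show ?thesis by (simp add: dickman_deriv_def d)
  qed
qed

definition is_buchstab :: "(real \<Rightarrow> real) \<Rightarrow> bool" where
  "is_buchstab w \<longleftrightarrow>
     (\<forall>u<1. w u = 0) \<and> (\<forall>u\<in>{1..2}. w u = 1 / u) \<and> continuous_on {1..} w \<and>
     (\<forall>u>2. ((\<lambda>t. t * w t) has_real_derivative w (u - 1)) (at u))"

definition buchstab :: "real \<Rightarrow> real" where
  "buchstab = (THE w. is_buchstab w)"

lemma buchstab_ex1: "\<exists>!w. is_buchstab w"
proof (rule ex_ex1I)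
  have "continuous_on {1..} (\<lambda>u::real. 1 / u)" by (intro continuous_intros) auto
  from delay_equation_ex[OF this] obtain F where
    F1: "\<And>u. u \<le> 1 \<Longrightarrow> F u = 1" and Fc: "continuous_on UNIV F" and
    Fd: "\<And>u. u > 1 \<Longrightarrow> (F has_real_derivative (1 / u) * F (u - 1)) (at u)"
    by blast
  define w where "w u = (if u < 1 then 0 else F (u - 1) / u)" for u
  have "continuous_on {1..} (\<lambda>u. F (u - 1) / u)"
    by (intro continuous_intros continuous_on_compose2[OF Fc]) auto
  then have "continuous_on {1..} w"
    using continuous_on_cong[of "{1..}" "{1..}" w "\<lambda>u. F (u - 1) / u"] by (simp add: w_def)
  moreover have "((\<lambda>t. t * w t) has_real_derivative w (u - 1)) (at u)" if u: "u > 2" for u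
  proof -
    have "((\<lambda>t. F (t - 1)) has_real_derivative (1 / (u - 1)) * F (u - 1 - 1)) (at u)"
      using DERIV_shift[of F _ u "- 1"] Fd[of "u - 1"] u by simp
    moreover have "\<forall>\<^sub>F t in nhds u. t * w t = F (t - 1)"
      using eventually_nhds_in_open[of "{1<..}" u] u
      by (auto elim!: eventually_mono simp: w_def)
    ultimately show ?thesis
      using DERIV_cong_ev[of u u "\<lambda>t. t * w t" "\<lambda>t. F (t - 1)"] u by (simp add: w_def)
  qed
  ultimately have "is_buchstab w" by (auto simp: is_buchstab_def w_def F1)
  then show "\<exists>w. is_buchstab w" by (rule exI[where P = is_buchstab])
next
  fix v w assume v: "is_buchstab v" and w: "is_buchstab w"
  let ?W = "\<lambda>w u. if u < 0 then 1 else (u + 1) * w (u + 1 :: real) :: real"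
  have cont: "continuous_on {1..} (?W w)" if "is_buchstab w" for w
  proof -
    have c: "continuous_on {1..} w" using that by (simp add: is_buchstab_def)
    have "continuous_on {1..} (\<lambda>u. w (u + 1))"
      by (rule continuous_on_compose2[OF c]) (auto intro!: continuous_intros)
    then have "continuous_on {1..} (\<lambda>u. (u + 1) * w (u + 1))"
      by (intro continuous_on_mult) (auto intro!: continuous_intros)
    then show ?thesis
      using continuous_on_cong[of "{1..}" "{1..}" "?W w" "\<lambda>u. (u + 1) * w (u + 1)"] by simp
  qed
  have der: "(?W w has_real_derivative (1 / u) * ?W w (u - 1)) (at u)"
    if "is_buchstab w" and u: "u > 1" for w u
  proof -
    have "((\<lambda>t. t * w t) has_real_derivative w u) (at (u + 1))"
      using that unfolding is_buchstab_def by (metis add_diff_cancel_right' add_strict_right_mono one_add_one)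
    then have "((\<lambda>t. (t + 1) * w (t + 1)) has_real_derivative w u) (at u)"
      using DERIV_shift[of "\<lambda>t. t * w t" _ u 1] by simp
    moreover have "\<forall>\<^sub>F t in nhds u. ?W w t = (t + 1) * w (t + 1)"
      using eventually_nhds_in_open[of "{0<..}" u] u by (auto elim!: eventually_mono)
    ultimately have "(?W w has_real_derivative w u) (at u)"
      using DERIV_cong_ev[of u u "?W w" "\<lambda>t. (t + 1) * w (t + 1)"] by simp
    then show ?thesis using u by simp
  qed
  have "?W v = ?W w"
  proof (rule delay_equation_unique[where k = "\<lambda>u. 1 / u"])
    fix u :: real assume "u \<le> 1"
    then show "?W v u = ?W w u" using v w by (auto simp: is_buchstab_def)
  qed (use cont[OF v] cont[OF w] der[OF v] der[OF w] in auto)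
  show "v = w"
  proof
    fix u :: real
    show "v u = w u"
    proof (cases "u < 1")
      case True
      then show ?thesis using v w by (auto simp: is_buchstab_def)
    next
      case False
      then show ?thesis using fun_cong[OF \<open>?W v = ?W w\<close>, of "u - 1"] by simp
    qed
  qed
qed

lemma is_buchstab_buchstab: "is_buchstab buchstab"
  unfolding buchstab_def by (rule theI'[OF buchstab_ex1])

definition smooth_numbers :: "real \<Rightarrow> nat set" where
  "smooth_numbers y = {n. n \<ge> 1 \<and> (\<forall>p. prime p \<and> p dvd n \<longrightarrow> real p \<le> y)}"

definition Psi :: "real \<Rightarrow> real \<Rightarrow> nat" where
  "Psi x y = card {n \<in> smooth_numbers y. real n \<le> x}"

definition Phi :: "real \<Rightarrow> real \<Rightarrow> nat" where
  "Phi x y = card {n::nat. n \<ge> 1 \<and> real n \<le> x \<and> (\<forall>p. prime p \<and> p dvd n \<longrightarrow> real p > y)}"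

definition prime_prod :: "real \<Rightarrow> real" where
  "prime_prod y = (\<Prod>p\<in>{p::nat. prime p \<and> real p \<le> y}. 1 - 1 / real p)"

definition mu :: "real \<Rightarrow> real \<Rightarrow> real" where
  "mu y u = integral {0..u} (\<lambda>v. buchstab (u - v) * y powr (- v))"

definition Lambda :: "real \<Rightarrow> real \<Rightarrow> real" where
  "Lambda x y =
     (let u = ln x / ln y in
        x * dickman u - frac x
          - x * integral {0..u} (\<lambda>v. dickman_deriv (u - v) * (frac (y powr v) / y powr v)))"

definition Delta :: "real \<Rightarrow> real \<Rightarrow> real" where
  "Delta x y = real (Psi x y) - Lambda x y"

definition V_star :: "real \<Rightarrow> real \<Rightarrow> real" where
  "V_star x y = (if x \<ge> 1 then 1 else 0) + x * mu y (ln x / ln y)"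

definition Q_star :: "real \<Rightarrow> real \<Rightarrow> real" where
  "Q_star x y = V_star x y - real (Phi x y)"

lemma Q_star_less_1:
  assumes "0 < x" "x < 1" "y \<ge> 2"
  shows "Q_star x y = 0"
proof -
  have "ln x / ln y < 0" using assms by (simp add: divide_neg_pos)
  moreover have "Phi x y = 0"
    using assms by (auto simp: Phi_def intro!: card_eq_0_iff[THEN iffD2])
  ultimately show ?thesis
    using assms by (simp add: Q_star_def V_star_def mu_def)
qed

(* All terms with n > x vanish, so the infinite sum has finite support. *)
definition R_star :: "real \<Rightarrow> real \<Rightarrow> real" where
  "R_star x y = (\<Sum>\<^sub>\<infinity>n\<in>smooth_numbers y. Q_star (x / real n) y)"

end

theory Submission
  imports Defs
begin

text \<open>
  Put \<open>x = y\<^sup>u\<close>, divide every counting function by \<open>x\<close> and write \<open>\<star>\<close> for the convolution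
  \<open>(f \<star> g)(u) = \<integral> f(v) g(u - v) dv\<close> of functions that vanish on the negative axis. The bound for
  \<open>R\<^sup>*\<close> rests on the exact identity
  \<open>R\<^sup>*(y\<^sup>u) / y\<^sup>u = D(u) + (\<omega> \<star> D)(u)\<close>, where \<open>D(u) = \<Delta>(y\<^sup>u, y) / y\<^sup>u\<close> (lemma \<open>R_star_eq_conv\<close>).

  The identity has an arithmetic and an analytic half. Arithmetically, each integer factors uniquely
  into a smooth and a rough part, so that summing \<open>\<Phi>(x/n, y)\<close> over smooth \<open>n\<close> yields \<open>\<lfloor>x\<rfloor>\<close>
  (\<open>sum_Phi_eq_floor\<close>); and since \<open>\<mu>\<^sub>y\<close> is itself the convolution of \<open>\<omega>\<close> with \<open>y\<^sup>-\<^sup>v\<close>, summing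
  \<open>V\<^sup>*(x/n, y)\<close> yields \<open>\<Psi> + \<omega> \<star> \<Psi>\<close> (\<open>buchstab_conv_normalized_Psi\<close>). Analytically, the approximation
  \<open>\<Lambda>\<close> is built so that \<open>\<Lambda> + \<omega> \<star> \<Lambda>\<close> is exactly \<open>\<lfloor>x\<rfloor>\<close> (\<open>normalized_Lambda_identity\<close>). The reason is
  that \<open>\<rho>' + \<omega> + \<omega> \<star> \<rho>' = 0\<close> (\<open>buchstab_conv_dickman_deriv\<close>), that is, \<open>\<delta> + \<omega>\<close> and the distributional
  derivative \<open>\<delta> + \<rho>'\<close> of \<open>\<rho>\<close> are inverse to each other. This in turn is a formal consequence of the
  two delay equations, because multiplication by the variable is a derivation for \<open>\<star>\<close>.

  Integrating the inverse relation gives \<open>\<rho> + \<omega> \<star> \<rho> = 1\<close> on the positive axis. Since \<open>\<omega> \<ge> 0\<close>, the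
  hypothesis \<open>\<bar>D\<bar> \<le> f(y) \<rho>\<close> on \<open>[0, u]\<close> therefore gives \<open>\<bar>D + \<omega> \<star> D\<bar> \<le> f(y)\<close>, which is the
  first claim.

  For the second claim, \<open>Q\<^sup>*\<close> is recovered from \<open>R\<^sup>*\<close> by removing the primes up to \<open>y\<close> from the
  summation one at a time. Each step replaces \<open>R(x)\<close> by \<open>R(x) - R(x/p)\<close> and multiplies a bound of the
  form \<open>C x\<close> by at most \<open>1 + 1/p\<close>, hence by at most \<open>1 / (1 - 1/p)\<close>
  (\<open>dilate_sum_inversion_bound\<close>).
\<close>

section \<open>Convolution of causal functions\<close>

text \<open>
  A convolution algebra on the half-line that contains all functions of the problem at once: they
  vanish on the negative axis and are bounded on bounded sets. For such functions the convolution
  over the whole line is an integral over a compact interval, so it always converges, and it is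
  translation invariant without any case distinction at the end points.
\<close>
definition causal :: "(real \<Rightarrow> real) \<Rightarrow> bool" where
  "causal f \<longleftrightarrow> f \<in> borel_measurable borel \<and> (\<forall>u<0. f u = 0) \<and>
     (\<forall>T. \<exists>B. \<forall>u\<le>T. \<bar>f u\<bar> \<le> B)"

definition conv :: "(real \<Rightarrow> real) \<Rightarrow> (real \<Rightarrow> real) \<Rightarrow> real \<Rightarrow> real" (infixl "\<star>" 70) where
  "(f \<star> g) u = (\<integral>v. f v * g (u - v) \<partial>lborel)"

lemma causal_measurable [measurable_dest]: "causal f \<Longrightarrow> f \<in> borel_measurable borel"
  by (simp add: causal_def)

lemma causal_neg: "causal f \<Longrightarrow> u < 0 \<Longrightarrow> f u = 0"
  by (simp add: causal_def)

lemma causal_bound: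
  assumes "causal f"
  obtains B where "B \<ge> 0" "\<And>u. u \<le> T \<Longrightarrow> \<bar>f u\<bar> \<le> B"
proof -
  obtain B where B: "\<And>u. u \<le> T \<Longrightarrow> \<bar>f u\<bar> \<le> B" using assms unfolding causal_def by blast
  have "B \<ge> 0" using B[of T] by simp
  with B that show ?thesis by blast
qed

lemma causalI:
  assumes "f \<in> borel_measurable borel" "\<And>u. u < 0 \<Longrightarrow> f u = 0"
    and "\<And>T. T \<ge> 0 \<Longrightarrow> \<exists>B. \<forall>u\<in>{0..T}. \<bar>f u\<bar> \<le> B"
  shows "causal f"
proof -
  have "\<exists>B. \<forall>u\<le>T. \<bar>f u\<bar> \<le> B" for T
  proof -
    obtain B where B: "\<forall>u\<in>{0..max T 0}. \<bar>f u\<bar> \<le> B" using assms(3)[of "max T 0"] by auto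
    then have "0 \<le> B" by (force intro: order_trans[OF abs_ge_zero])
    then have "\<bar>f u\<bar> \<le> B" if "u \<le> T" for u
      using B assms(2)[of u] that by (cases "u < 0") auto
    then show ?thesis by blast
  qed
  then show ?thesis using assms by (auto simp: causal_def)
qed

lemma causal_continuous_on:
  assumes c: "continuous_on {a..} f" and z: "\<And>u. u < a \<Longrightarrow> f u = 0" and a: "a \<ge> 0"
  shows "causal f"
proof (rule causalI)
  have "(\<lambda>u. if u \<in> {a..} then f u else 0) \<in> borel_measurable borel"
    using c by (intro borel_measurable_continuous_on_if) auto
  moreover have "(\<lambda>u. if u \<in> {a..} then f u else 0) = f" using z by fastforce
  ultimately show "f \<in> borel_measurable borel" by simp
  show "f u = 0" if "u < 0" for u using that a by (intro z) simp
  fix T :: real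
  have "compact (f ` {a..T})"
    by (intro compact_continuous_image continuous_on_subset[OF c]) auto
  then obtain B where B: "\<forall>x\<in>{a..T}. \<bar>f x\<bar> \<le> B"
    by (fastforce dest: compact_imp_bounded simp: bounded_iff)
  have "\<bar>f u\<bar> \<le> max B 0" if "u \<in> {0..T}" for u
    using B that z[of u] by (cases "u < a") (auto simp: le_max_iff_disj)
  then show "\<exists>B. \<forall>u\<in>{0..T}. \<bar>f u\<bar> \<le> B" by blast
qed

lemma causal_add: "causal f \<Longrightarrow> causal g \<Longrightarrow> causal (\<lambda>u. f u + g u)"
proof (rule causalI)
  assume f: "causal f" and g: "causal g"
  then show "(\<lambda>u. f u + g u) \<in> borel_measurable borel" by measurable
  show "f u + g u = 0" if "u < 0" for u using causal_neg[OF f that] causal_neg[OF g that] by simp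
  fix T :: real
  obtain A B where "\<And>u. u \<le> T \<Longrightarrow> \<bar>f u\<bar> \<le> A" "\<And>u. u \<le> T \<Longrightarrow> \<bar>g u\<bar> \<le> B"
    using causal_bound[OF f] causal_bound[OF g] by metis
  then have "\<forall>u\<in>{0..T}. \<bar>f u + g u\<bar> \<le> A + B" by (fastforce intro: order_trans[OF abs_triangle_ineq] add_mono)
  then show "\<exists>B. \<forall>u\<in>{0..T}. \<bar>f u + g u\<bar> \<le> B" by blast
qed

lemma causal_mult_bounded:
  assumes f: "causal f" and [measurable]: "k \<in> borel_measurable borel"
    and k: "\<And>T. T \<ge> 0 \<Longrightarrow> \<exists>B. \<forall>u\<in>{0..T}. \<bar>k u\<bar> \<le> B"
  shows "causal (\<lambda>u. k u * f u)"
proof (rule causalI)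
  show "(\<lambda>u. k u * f u) \<in> borel_measurable borel" using f by measurable
  show "k u * f u = 0" if "u < 0" for u using causal_neg[OF f that] by simp
  fix T :: real assume "T \<ge> 0"
  then obtain A where A: "\<forall>u\<in>{0..T}. \<bar>k u\<bar> \<le> A" using k by blast
  obtain B where B: "B \<ge> 0" "\<And>u. u \<le> T \<Longrightarrow> \<bar>f u\<bar> \<le> B" using causal_bound[OF f] by metis
  have "\<bar>k u * f u\<bar> \<le> A * B" if "u \<in> {0..T}" for u
    unfolding abs_mult using A B that by (intro mult_mono) (auto intro: order_trans[OF abs_ge_zero])
  then show "\<exists>B. \<forall>u\<in>{0..T}. \<bar>k u * f u\<bar> \<le> B" by blast
qed

lemma causal_cmult: "causal f \<Longrightarrow> causal (\<lambda>u. c * f u)"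
  by (rule causal_mult_bounded) auto

lemma causal_uminus: "causal f \<Longrightarrow> causal (\<lambda>u. - f u)"
  using causal_cmult[of f "-1"] by simp

lemma causal_diff: "causal f \<Longrightarrow> causal g \<Longrightarrow> causal (\<lambda>u. f u - g u)"
  using causal_add[OF _ causal_uminus, of f g] by simp

lemma causal_ident_mult: "causal f \<Longrightarrow> causal (\<lambda>u. u * f u)"
  by (rule causal_mult_bounded) auto

lemma causal_shift:
  assumes f: "causal f" and c: "c \<ge> 0"
  shows "causal (\<lambda>u. f (u - c))"
proof (rule causalI)
  have [measurable]: "f \<in> borel_measurable borel" using f by (rule causal_measurable)
  show "(\<lambda>u. f (u - c)) \<in> borel_measurable borel" by measurable
  show "f (u - c) = 0" if "u < 0" for u using causal_neg[OF f] that c by simp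
  fix T :: real
  obtain B where B: "B \<ge> 0" "\<And>u. u \<le> T - c \<Longrightarrow> \<bar>f u\<bar> \<le> B" using causal_bound[OF f] by metis
  then show "\<exists>B. \<forall>u\<in>{0..T}. \<bar>f (u - c)\<bar> \<le> B" by (intro exI[of _ B]) auto
qed

lemma conv_integrand_bound:
  assumes f: "causal f" and g: "causal g"
  obtains B where "B \<ge> 0" "\<And>u v. u \<le> T \<Longrightarrow> \<bar>f v * g (u - v)\<bar> \<le> B * indicator {0..u} v"
proof -
  obtain A where A: "A \<ge> 0" "\<And>u. u \<le> T \<Longrightarrow> \<bar>f u\<bar> \<le> A" using causal_bound[OF f] by metis
  obtain B where B: "B \<ge> 0" "\<And>u. u \<le> T \<Longrightarrow> \<bar>g u\<bar> \<le> B" using causal_bound[OF g] by metis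
  have "\<bar>f v * g (u - v)\<bar> \<le> A * B * indicator {0..u} v" if "u \<le> T" for u v
  proof (cases "v \<in> {0..u}")
    case True
    then show ?thesis using A B that by (auto simp: abs_mult intro!: mult_mono)
  next
    case False
    then show ?thesis using causal_neg[OF f, of v] causal_neg[OF g, of "u - v"] by auto
  qed
  with A B that[of "A * B"] show ?thesis by simp
qed

lemma conv_integrable:
  assumes f: "causal f" and g: "causal g"
  shows "integrable lborel (\<lambda>v. f v * g (u - v))"
proof -
  obtain B where "B \<ge> 0" "\<And>t v. t \<le> u \<Longrightarrow> \<bar>f v * g (t - v)\<bar> \<le> B * indicator {0..t} v"
    using conv_integrand_bound[OF f g, of u] by blast
  then have B: "\<bar>f v * g (u - v)\<bar> \<le> B * indicator {0..u} v" for v by simp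
  show ?thesis
  proof (rule Bochner_Integration.integrable_bound)
    show "integrable lborel (\<lambda>v. B * indicator {0..u} v :: real)"
      by (intro integrable_mult_right integrable_real_indicator) (auto simp: emeasure_lborel_Icc_eq)
    have [measurable]: "f \<in> borel_measurable borel" "g \<in> borel_measurable borel"
      using f g by (auto dest: causal_measurable)
    show "(\<lambda>v. f v * g (u - v)) \<in> borel_measurable lborel" by measurable
    show "AE v in lborel. norm (f v * g (u - v)) \<le> norm (B * indicator {0..u} v)"
      using order_trans[OF B abs_ge_self] by (intro AE_I2) simp
  qed
qed

lemma causal_conv:
  assumes f: "causal f" and g: "causal g"
  shows "causal (f \<star> g)"
proof (rule causalI)
  have [measurable]: "f \<in> borel_measurable borel" "g \<in> borel_measurable borel"
    using f g by (auto dest: causal_measurable)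
  show "f \<star> g \<in> borel_measurable borel" unfolding conv_def by measurable
  show "(f \<star> g) u = 0" if "u < 0" for u
  proof -
    have "f v * g (u - v) = 0" for v
      using causal_neg[OF f, of v] causal_neg[OF g, of "u - v"] that by (cases "v < 0") auto
    then have "(f \<star> g) u = (\<integral>v. 0 \<partial>(lborel :: real measure))" unfolding conv_def by presburger
    then show ?thesis by simp
  qed
  fix T :: real
  obtain B where B: "B \<ge> 0" "\<And>u v. u \<le> T \<Longrightarrow> \<bar>f v * g (u - v)\<bar> \<le> B * indicator {0..u} v"
    using conv_integrand_bound[OF f g, of T] by blast
  have "\<bar>(f \<star> g) u\<bar> \<le> B * T" if u: "u \<in> {0..T}" for u
  proof -
    have "\<bar>(f \<star> g) u\<bar> \<le> (\<integral>v. \<bar>f v * g (u - v)\<bar> \<partial>lborel)"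
      unfolding conv_def by simp
    also have "\<dots> \<le> (\<integral>v. B * indicator {0..u} v \<partial>lborel)"
      using u by (intro integral_mono integrable_abs conv_integrable[OF f g] B) auto
    also have "\<dots> = B * u" using u by simp
    also have "\<dots> \<le> B * T" using u B by (intro mult_left_mono) auto
    finally show ?thesis .
  qed
  then show "\<exists>B. \<forall>u\<in>{0..T}. \<bar>(f \<star> g) u\<bar> \<le> B" by blast
qed

lemma conv_commute: "f \<star> g = g \<star> f"
proof
  fix u :: real
  have "(f \<star> g) u = (\<integral>v. f (u - v) * g (u - (u - v)) \<partial>lborel)"
    unfolding conv_def using lborel_integral_real_affine[of "-1" "\<lambda>v. f v * g (u - v)" u] by simp
  then show "(f \<star> g) u = (g \<star> f) u" by (simp add: conv_def mult.commute)
qed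

lemma conv_add_left:
  "causal f \<Longrightarrow> causal g \<Longrightarrow> causal h \<Longrightarrow> ((\<lambda>u. f u + g u) \<star> h) u = (f \<star> h) u + (g \<star> h) u"
  unfolding conv_def distrib_right
  by (rule Bochner_Integration.integral_add[OF conv_integrable conv_integrable])

lemma conv_cmult_left: "((\<lambda>u. c * f u) \<star> g) u = c * (f \<star> g) u"
  unfolding conv_def by (simp add: mult.assoc)

lemma conv_uminus_left: "((\<lambda>u. - f u) \<star> g) u = - (f \<star> g) u"
  using conv_cmult_left[of "-1" f g u] by simp

lemma conv_diff_left:
  "causal f \<Longrightarrow> causal g \<Longrightarrow> causal h \<Longrightarrow> ((\<lambda>u. f u - g u) \<star> h) u = (f \<star> h) u - (g \<star> h) u"
  using conv_add_left[OF _ causal_uminus, of f g h u] by (simp add: conv_uminus_left)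

lemma conv_shift_left: "((\<lambda>u. f (u - c)) \<star> g) u = (f \<star> g) (u - c)"
  unfolding conv_def
  using lborel_integral_real_affine[of 1 "\<lambda>v. f (v - c) * g (u - v)" c]
  by (simp add: diff_diff_eq)

lemma conv_diff_right:
  "causal f \<Longrightarrow> causal g \<Longrightarrow> causal h \<Longrightarrow> (f \<star> (\<lambda>u. g u - h u)) u = (f \<star> g) u - (f \<star> h) u"
  using conv_diff_left[of g h f u] by (simp add: conv_commute)

lemma conv_cmult_right: "(f \<star> (\<lambda>u. c * g u)) u = c * (f \<star> g) u"
  using conv_cmult_left[of c g f u] by (simp add: conv_commute)

lemma conv_uminus_right: "(f \<star> (\<lambda>u. - g u)) u = - (f \<star> g) u"
  using conv_uminus_left[of g f u] by (simp add: conv_commute)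

lemma conv_shift_right: "(f \<star> (\<lambda>u. g (u - c))) u = (f \<star> g) (u - c)"
  using conv_shift_left[of g c f u] by (simp add: conv_commute)

lemma conv_sum_right:
  assumes "causal f" "\<And>n. n \<in> N \<Longrightarrow> causal (g n)"
  shows "(f \<star> (\<lambda>u. \<Sum>n\<in>N. g n u)) u = (\<Sum>n\<in>N. (f \<star> g n) u)"
  unfolding conv_def sum_distrib_left
  by (rule Bochner_Integration.integral_sum[OF conv_integrable[OF assms]])

text \<open>
  Multiplication by the variable is a derivation of the convolution algebra, because
  \<open>u = v + (u - v)\<close>. This is what turns delay equations, where the variable multiplies the unknown
  function, into algebraic identities between convolutions.
\<close>
lemma ident_mult_conv:
  assumes f: "causal f" and g: "causal g"
  shows "u * (f \<star> g) u = ((\<lambda>t. t * f t) \<star> g) u + (f \<star> (\<lambda>t. t * g t)) u"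
proof -
  have "u * (f \<star> g) u = (\<integral>v. v * f v * g (u - v) + f v * ((u - v) * g (u - v)) \<partial>lborel)"
  proof -
    have "v * f v * g (u - v) + f v * ((u - v) * g (u - v)) = u * (f v * g (u - v))" for v
      by (simp add: algebra_simps)
    then show ?thesis unfolding conv_def by simp
  qed
  also have "\<dots> = ((\<lambda>t. t * f t) \<star> g) u + (f \<star> (\<lambda>t. t * g t)) u"
    unfolding conv_def
    using conv_integrable[OF causal_ident_mult[OF f] g] conv_integrable[OF f causal_ident_mult[OF g]]
    by (intro Bochner_Integration.integral_add) auto
  finally show ?thesis .
qed

text \<open>
  Associativity is Fubini's theorem: the integrand is bounded and lives on the square
  \<open>{0..u} \<times> {0..u}\<close>.
\<close>
lemma conv_assoc:
  assumes f: "causal f" and g: "causal g" and h: "causal h"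
  shows "(f \<star> g) \<star> h = f \<star> (g \<star> h)"
proof
  fix u :: real
  have [measurable]: "f \<in> borel_measurable borel" "g \<in> borel_measurable borel" "h \<in> borel_measurable borel"
    using f g h by (auto dest: causal_measurable)
  let ?I = "\<lambda>w v. f w * g (v - w) * h (u - v)"
  obtain A where A: "A \<ge> 0" "\<And>v w. v \<le> u \<Longrightarrow> \<bar>f w * g (v - w)\<bar> \<le> A * indicator {0..v} w"
    using conv_integrand_bound[OF f g, of u] by blast
  obtain B where B: "B \<ge> 0" "\<And>t. t \<le> u \<Longrightarrow> \<bar>h t\<bar> \<le> B" using causal_bound[OF h] by metis
  have bound: "\<bar>?I w v\<bar> \<le> A * B * indicator ({0..u} \<times> {0..u}) (w, v)" for w v
  proof (cases "0 \<le> w \<and> w \<le> v \<and> v \<le> u")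
    case True
    then show ?thesis using A(2)[of v w] B(2)[of "u - v"] A(1)
      by (auto simp: abs_mult[of _ "h _"] intro!: mult_mono)
  next
    case False
    then show ?thesis
      using causal_neg[OF f, of w] causal_neg[OF g, of "v - w"] causal_neg[OF h, of "u - v"] A B
      by force
  qed
  have int: "integrable (lborel \<Otimes>\<^sub>M lborel) (\<lambda>(w, v). ?I w v)"
  proof (rule Bochner_Integration.integrable_bound)
    have "emeasure (lborel \<Otimes>\<^sub>M lborel) ({0..u} \<times> {0..u}) < \<infinity>"
      by (subst lborel.emeasure_pair_measure_Times) (auto simp: ennreal_mult_less_top emeasure_lborel_Icc_eq)
    then show "integrable (lborel \<Otimes>\<^sub>M lborel)
        (\<lambda>z. A * B * indicator ({0..u} \<times> {0..u}) z :: real)"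
      by (intro integrable_mult_right integrable_real_indicator) auto
    show "(\<lambda>(w, v). ?I w v) \<in> borel_measurable (lborel \<Otimes>\<^sub>M lborel)" by measurable
    show "AE z in lborel \<Otimes>\<^sub>M lborel. norm ((\<lambda>(w, v). ?I w v) z)
        \<le> norm (A * B * indicator ({0..u} \<times> {0..u}) z)"
      using order_trans[OF bound abs_ge_self] by (intro AE_I2) (simp split: prod.split)
  qed
  have "((f \<star> g) \<star> h) u = (\<integral>v. (\<integral>w. ?I w v \<partial>lborel) \<partial>lborel)"
    unfolding conv_def by simp
  also have "\<dots> = (\<integral>w. (\<integral>v. ?I w v \<partial>lborel) \<partial>lborel)"
    by (rule lborel_pair.Fubini_integral[OF int])
  also have "\<dots> = (f \<star> (g \<star> h)) u"
  proof -
    have "(\<integral>v. ?I w v \<partial>lborel) = f w * (g \<star> h) (u - w)" for w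
      using conv_shift_left[of g w h u] unfolding conv_def by (simp add: mult.assoc)
    then show ?thesis unfolding conv_def[of f] by simp
  qed
  finally show "((f \<star> g) \<star> h) u = (f \<star> (g \<star> h)) u" .
qed

text \<open>
  The bridge to the gauge integrals over \<open>{0..u}\<close> in terms of which \<open>\<Lambda>\<close> and \<open>\<mu>\<^sub>y\<close> are defined.
\<close>
lemma conv_eq_integral:
  assumes f: "causal f" and g: "causal g"
  shows "(f \<star> g) u = integral {0..u} (\<lambda>v. f v * g (u - v))"
proof -
  have z: "f v * g (u - v) = indicator {0..u} v * (f v * g (u - v))" for v
    using causal_neg[OF f, of v] causal_neg[OF g, of "u - v"] by (cases "v < 0"; cases "u < v") auto
  have s: "set_integrable lborel {0..u} (\<lambda>v. f v * g (u - v))"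
    using conv_integrable[OF f g, of u] unfolding set_integrable_def by (simp flip: z)
  have "(f \<star> g) u = (LINT v:{0..u}|lborel. f v * g (u - v))"
    unfolding conv_def set_lebesgue_integral_def by (simp flip: z)
  then show ?thesis using set_borel_integral_eq_integral(2)[OF s] by simp
qed

lemma conv_mono:
  assumes f: "causal f" and g: "causal g" and h: "causal h"
    and f0: "\<And>v. f v \<ge> 0" and le: "\<And>v. v \<le> u \<Longrightarrow> \<bar>g v\<bar> \<le> h v"
  shows "\<bar>(f \<star> g) u\<bar> \<le> (f \<star> h) u"
proof -
  have "\<bar>(f \<star> g) u\<bar> \<le> (\<integral>v. \<bar>f v * g (u - v)\<bar> \<partial>lborel)"
    unfolding conv_def by simp
  also have "\<dots> \<le> (f \<star> h) u" unfolding conv_def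
  proof (intro integral_mono integrable_abs conv_integrable f g h)
    fix v :: real
    show "\<bar>f v * g (u - v)\<bar> \<le> f v * h (u - v)"
      using f0[of v] le[of "u - v"] causal_neg[OF f, of v]
      by (cases "v < 0") (auto simp: abs_mult intro: mult_left_mono)
  qed
  finally show ?thesis .
qed

lemma conv_cong:
  assumes "causal f" "\<And>v. v \<le> u \<Longrightarrow> g v = h v"
  shows "(f \<star> g) u = (f \<star> h) u"
  unfolding conv_def
proof (rule Bochner_Integration.integral_cong)
  show "f v * g (u - v) = f v * h (u - v)" for v
    using assms(2)[of "u - v"] causal_neg[OF assms(1), of v] by (cases "v < 0") auto
qed simp

section \<open>Dickman and Buchstab functions as convolution inverses\<close>

abbreviation unit_step :: "real \<Rightarrow> real" where
  "unit_step \<equiv> indicator {0..}"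

lemma causal_unit_step: "causal unit_step"
  by (rule causalI) (auto intro!: exI[of _ 1] split: split_indicator)

lemma unit_step_conv_eq_integral:
  assumes "causal f"
  shows "(unit_step \<star> f) u = integral {0..u} f"
proof -
  have "(unit_step \<star> f) u = integral {0..u} (\<lambda>v. f v * unit_step (u - v))"
    by (subst conv_commute) (rule conv_eq_integral[OF assms causal_unit_step])
  also have "\<dots> = integral {0..u} f" by (rule integral_cong) auto
  finally show ?thesis .
qed

lemma dickman_neg: "u < 0 \<Longrightarrow> dickman u = 0"
  and dickman_le_1: "0 \<le> u \<Longrightarrow> u \<le> 1 \<Longrightarrow> dickman u = 1"
  and continuous_on_dickman: "continuous_on {0..} dickman"
  using is_dickman_dickman by (auto simp: is_dickman_def)

lemma causal_dickman: "causal dickman"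
  by (rule causal_continuous_on[OF continuous_on_dickman dickman_neg]) auto

text \<open>
  Since \<open>\<rho>\<close> vanishes on the negative axis, the delay equation holds on the whole line, including the
  points \<open>0\<close> and \<open>1\<close>, where \<open>\<rho>'\<close> is fixed by right-continuity. At \<open>u = 0\<close> the right-hand side is
  \<open>0\<close> because \<open>\<rho>(-1) = 0\<close>.
\<close>
lemma dickman_deriv_eq: "dickman_deriv u = - dickman (u - 1) / u"
proof (cases "u < 0")
  case True
  have "(dickman has_real_derivative 0) (at u)"
  proof (rule has_field_derivative_transform_within_open[where f = "\<lambda>_. 0"])
    show "open {..<0::real}" by simp
  qed (use True dickman_neg in auto)
  then show ?thesis using True by (simp add: dickman_deriv_def DERIV_imp_deriv dickman_neg)
next
  case False
  then show ?thesis
    using dickman_deriv_ge_1[of u] dickman_deriv_less_1[of u] dickman_neg[of "u - 1"] by fastforce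
qed

lemma causal_dickman_deriv: "causal dickman_deriv"
proof (rule causal_continuous_on)
  have "continuous_on {1..} (\<lambda>u. - dickman (u - 1) / u)"
    by (intro continuous_intros continuous_on_compose2[OF continuous_on_dickman]) auto
  then show "continuous_on {1..} dickman_deriv" by (simp add: dickman_deriv_eq[abs_def])
  show "dickman_deriv u = 0" if "u < 1" for u
    using dickman_neg[of "u - 1"] that by (simp add: dickman_deriv_eq)
qed auto

text \<open>
  The unit step comes from the jump of \<open>\<rho>\<close> at \<open>0\<close>: as a distribution, the derivative of \<open>\<rho>\<close> is the
  point mass at \<open>0\<close> plus \<open>\<rho>'\<close>.
\<close>
lemma unit_step_conv_dickman_deriv:
  "(unit_step \<star> dickman_deriv) u = dickman u - unit_step u"
proof (cases "u < 0")
  case True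
  then show ?thesis
    by (simp add: dickman_neg causal_neg[OF causal_conv[OF causal_unit_step causal_dickman_deriv]])
next
  case False
  have "(dickman_deriv has_integral dickman u - dickman 0) {0..u}"
  proof (rule fundamental_theorem_of_calculus_interior_strong[where S = "{1}"])
    show "continuous_on {0..u} dickman" by (rule continuous_on_subset[OF continuous_on_dickman]) auto
    fix x :: real assume x: "x \<in> {0<..<u} - {1}"
    show "(dickman has_vector_derivative dickman_deriv x) (at x)"
      unfolding has_real_derivative_iff_has_vector_derivative[symmetric]
    proof (cases "x < 1")
      case True
      then have "dickman_deriv x = 0" using x by (intro dickman_deriv_less_1) auto
      moreover have "(dickman has_real_derivative 0) (at x)"
      proof (rule has_field_derivative_transform_within_open[where f = "\<lambda>_. 1"])
        show "open {0<..<1::real}" by simp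
      qed (use True x dickman_le_1 in auto)
      ultimately show "(dickman has_real_derivative dickman_deriv x) (at x)" by simp
    next
      case False
      then show "(dickman has_real_derivative dickman_deriv x) (at x)"
        using is_dickman_has_derivative[OF is_dickman_dickman, of x] x by (simp add: dickman_deriv_eq)
    qed
  qed (use False in auto)
  then show ?thesis
    using False by (simp add: unit_step_conv_eq_integral[OF causal_dickman_deriv] integral_unique dickman_le_1)
qed

lemma buchstab_less_1: "u < 1 \<Longrightarrow> buchstab u = 0"
  and buchstab_le_2: "1 \<le> u \<Longrightarrow> u \<le> 2 \<Longrightarrow> buchstab u = 1 / u"
  and continuous_on_buchstab: "continuous_on {1..} buchstab"
  and buchstab_has_derivative:
    "u > 2 \<Longrightarrow> ((\<lambda>t. t * buchstab t) has_real_derivative buchstab (u - 1)) (at u)"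
  using is_buchstab_buchstab by (auto simp: is_buchstab_def)

lemma causal_buchstab: "causal buchstab"
  by (rule causal_continuous_on[OF continuous_on_buchstab buchstab_less_1]) auto

text \<open>
  The integrated form of \<open>(u \<omega>(u))' = \<omega>(u - 1)\<close>. Integration starts at \<open>u = 1\<close>, where \<open>u \<omega>(u) = 1\<close>;
  on \<open>[1, 2]\<close> it stays constant because \<open>\<omega>\<close> vanishes on \<open>[0, 1)\<close>.
\<close>
lemma ident_mult_buchstab:
  "u * buchstab u = unit_step (u - 1) + (unit_step \<star> buchstab) (u - 1)"
proof (cases "u < 1")
  case True
  then show ?thesis
    by (simp add: buchstab_less_1 causal_neg[OF causal_conv[OF causal_unit_step causal_buchstab]])
next
  case False
  let ?G = "\<lambda>t. (t + 1) * buchstab (t + 1)"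
  have "(buchstab has_integral ?G (u - 1) - ?G 0) {0..u - 1}"
  proof (rule fundamental_theorem_of_calculus_interior_strong[where S = "{1}"])
    show "continuous_on {0..u - 1} ?G"
      by (intro continuous_intros continuous_on_compose2[OF continuous_on_buchstab]) auto
    fix x :: real assume x: "x \<in> {0<..<u - 1} - {1}"
    show "(?G has_vector_derivative buchstab x) (at x)"
      unfolding has_real_derivative_iff_has_vector_derivative[symmetric]
    proof (cases "x < 1")
      case True
      have "(?G has_real_derivative 0) (at x)"
      proof (rule has_field_derivative_transform_within_open[where f = "\<lambda>_. 1"])
        show "open {0<..<1::real}" by simp
      qed (use True x buchstab_le_2 in auto)
      then show "(?G has_real_derivative buchstab x) (at x)" using True by (simp add: buchstab_less_1)
    next
      case False
      then show "(?G has_real_derivative buchstab x) (at x)"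
        using buchstab_has_derivative[of "x + 1"] x DERIV_shift[of "\<lambda>t. t * buchstab t" _ x 1] by simp
    qed
  qed (use False in auto)
  then have "(unit_step \<star> buchstab) (u - 1) = u * buchstab u - 1"
    by (simp add: unit_step_conv_eq_integral[OF causal_buchstab] integral_unique buchstab_le_2)
  then show ?thesis using False by simp
qed

text \<open>
  The integrated delay equation expresses \<open>\<omega>\<close> through its values at arguments smaller by \<open>1\<close>, so
  the sign propagates from one unit interval to the next.
\<close>
lemma buchstab_nonneg: "buchstab u \<ge> 0"
proof -
  have "\<forall>u \<le> real n. buchstab u \<ge> 0" for n
  proof (induction n)
    case 0
    then show ?case by (simp add: buchstab_less_1)
  next
    case (Suc n)
    show ?case
    proof (intro allI impI)
      fix u assume u: "u \<le> real (Suc n)"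
      have "(unit_step \<star> buchstab) (u - 1) \<ge> 0"
        unfolding conv_def using Suc u
        by (intro Bochner_Integration.integral_nonneg) (auto split: split_indicator)
      then have "u * buchstab u \<ge> 0"
        unfolding ident_mult_buchstab by simp
      then show "buchstab u \<ge> 0"
        by (cases "u < 1") (auto simp: buchstab_less_1 zero_le_mult_iff)
    qed
  qed
  then show ?thesis using real_arch_simple by blast
qed

text \<open>
  In distributional terms, \<open>\<delta> + \<omega>\<close> is the convolution inverse of \<open>\<delta> + \<rho>'\<close>, where \<open>\<delta>\<close> is the point
  mass at \<open>0\<close>. To see it, multiply \<open>\<rho>' + \<omega> + \<omega> \<star> \<rho>'\<close> by the variable. The derivation rule and the
  two delay equations express the product by \<open>\<rho>\<close>, \<open>\<omega>\<close> and \<open>\<omega> \<star> \<rho>\<close> at \<open>u - 1\<close>, and everything cancels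
  there. The identity is pointwise, not merely almost everywhere.
\<close>
lemma buchstab_conv_dickman_deriv:
  "(buchstab \<star> dickman_deriv) u = - dickman_deriv u - buchstab u"
proof (cases "u = 0")
  case True
  have "(buchstab \<star> dickman_deriv) 0 = 0"
    using conv_eq_integral[OF causal_buchstab causal_dickman_deriv, of 0] by simp
  then show ?thesis using True by (simp add: dickman_deriv_eq buchstab_less_1)
next
  case False
  note causal = causal_unit_step causal_dickman causal_dickman_deriv causal_buchstab
  \<comment> \<open>At \<open>t = 0\<close> both sides are \<open>0\<close>, again because \<open>\<rho>(-1) = 0\<close>.\<close>
  have t\<rho>': "t * dickman_deriv t = - dickman (t - 1)" for t
    using dickman_neg[of "-1"] by (simp add: dickman_deriv_eq)
  have "((\<lambda>t. t * buchstab t) \<star> dickman_deriv) u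
      = ((\<lambda>t. unit_step t + (unit_step \<star> buchstab) t) \<star> dickman_deriv) (u - 1)"
    unfolding ident_mult_buchstab
    by (rule conv_shift_left[of "\<lambda>t. unit_step t + (unit_step \<star> buchstab) t"])
  also have "\<dots> = (unit_step \<star> dickman_deriv) (u - 1)
      + ((unit_step \<star> buchstab) \<star> dickman_deriv) (u - 1)"
    by (intro conv_add_left causal_conv causal)
  also have "(unit_step \<star> buchstab) \<star> dickman_deriv = buchstab \<star> (unit_step \<star> dickman_deriv)"
    by (simp add: conv_commute[of unit_step buchstab] conv_assoc causal)
  also have "unit_step \<star> dickman_deriv = (\<lambda>u. dickman u - unit_step u)"
    by (rule ext) (rule unit_step_conv_dickman_deriv)
  also have "(buchstab \<star> (\<lambda>u. dickman u - unit_step u)) (u - 1)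
      = (buchstab \<star> dickman) (u - 1) - (unit_step \<star> buchstab) (u - 1)"
    by (simp add: conv_diff_right causal conv_commute[of unit_step])
  finally have 1: "((\<lambda>t. t * buchstab t) \<star> dickman_deriv) u
      = dickman (u - 1) - unit_step (u - 1) + ((buchstab \<star> dickman) (u - 1) - (unit_step \<star> buchstab) (u - 1))" .
  have 2: "(buchstab \<star> (\<lambda>t. t * dickman_deriv t)) u = - (buchstab \<star> dickman) (u - 1)"
    unfolding t\<rho>' by (simp add: conv_uminus_right conv_shift_right)
  have "u * (buchstab \<star> dickman_deriv) u = u * (- dickman_deriv u - buchstab u)"
    unfolding ident_mult_conv[OF causal_buchstab causal_dickman_deriv] 1 2 right_diff_distrib
    using t\<rho>'[of u] ident_mult_buchstab[of u] by simp
  then show ?thesis using False by simp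
qed

text \<open>
  The inverse relation integrated once. It is this identity that makes the majorant \<open>\<rho>\<close> in the
  hypothesis on \<open>\<Delta>\<close> collapse to the constant \<open>1\<close> in the bound for \<open>R\<^sup>*\<close>.
\<close>
lemma dickman_plus_buchstab_conv_dickman:
  "dickman u + (buchstab \<star> dickman) u = unit_step u"
proof -
  note causal = causal_unit_step causal_dickman causal_dickman_deriv causal_buchstab
  have "buchstab \<star> (unit_step \<star> dickman_deriv) = unit_step \<star> (buchstab \<star> dickman_deriv)"
    by (metis conv_assoc conv_commute causal)
  then have "(buchstab \<star> (\<lambda>u. dickman u - unit_step u)) u = (unit_step \<star> (\<lambda>u. - dickman_deriv u - buchstab u)) u"
    by (simp add: unit_step_conv_dickman_deriv[abs_def] buchstab_conv_dickman_deriv[abs_def])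
  then show ?thesis
    by (simp add: conv_diff_right conv_uminus_right causal causal_uminus
        unit_step_conv_dickman_deriv conv_commute[of buchstab unit_step])
qed

text \<open>
  With \<open>F(v) = {y\<^sup>v} / y\<^sup>v\<close> for \<open>v \<ge> 0\<close>, the value of \<open>L\<close> at \<open>u \<ge> 0\<close> is \<open>\<Lambda>(y\<^sup>u, y) / y\<^sup>u\<close>, and the
  right-hand side is \<open>\<lfloor>y\<^sup>u\<rfloor> / y\<^sup>u\<close>. The identity holds for any \<open>F\<close>: apart from \<open>\<rho>\<close>, \<open>L\<close> is minus the convolution of \<open>F\<close>
  with \<open>\<delta> + \<rho>'\<close>, whose inverse is \<open>\<delta> + \<omega>\<close>.
\<close>
lemma normalized_Lambda_identity:
  assumes F: "causal F"
  defines "L \<equiv> \<lambda>u. dickman u - F u - (F \<star> dickman_deriv) u"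
  shows "L u + (buchstab \<star> L) u = unit_step u - F u"
proof -
  note causal = causal_unit_step causal_dickman causal_dickman_deriv causal_buchstab F
  have "buchstab \<star> (F \<star> dickman_deriv) = F \<star> (buchstab \<star> dickman_deriv)"
    by (metis conv_assoc conv_commute causal)
  then have "(buchstab \<star> (F \<star> dickman_deriv)) u = - (F \<star> dickman_deriv) u - (buchstab \<star> F) u"
    by (simp add: buchstab_conv_dickman_deriv[abs_def] conv_diff_right conv_uminus_right causal
        causal_uminus conv_commute[of F buchstab])
  moreover have "(buchstab \<star> L) u = (buchstab \<star> dickman) u - (buchstab \<star> F) u - (buchstab \<star> (F \<star> dickman_deriv)) u"
    unfolding L_def by (simp add: conv_diff_right causal causal_conv causal_diff)
  ultimately show ?thesis using dickman_plus_buchstab_conv_dickman[of u] by (simp add: L_def)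
qed

section \<open>Factorization into smooth and rough parts\<close>

definition rough_numbers :: "real \<Rightarrow> nat set" where
  "rough_numbers y = {n. n \<ge> 1 \<and> (\<forall>p. prime p \<and> p dvd n \<longrightarrow> real p > y)}"

lemma finite_nat_le_real: "finite {n::nat. P n \<and> real n \<le> x}"
proof (rule finite_subset)
  show "{n::nat. P n \<and> real n \<le> x} \<subseteq> {..nat \<lfloor>x\<rfloor>}" by (auto simp: le_nat_floor)
qed simp

lemma prime_dvd_prime_mult:
  fixes p q m :: nat
  assumes "prime p" "prime q"
  shows "q dvd p * m \<longleftrightarrow> q = p \<or> q dvd m"
  using assms by (auto simp: prime_dvd_mult_iff dest: primes_dvd_imp_eq)

lemma coprime_smooth_rough:
  assumes "a \<in> smooth_numbers y" "b \<in> rough_numbers y"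
  shows "coprime a b"
proof (rule ccontr)
  assume "\<not> coprime a b"
  then obtain p where "prime p" "p dvd a" "p dvd b"
    using prime_factor_nat[of "gcd a b"] by (auto simp: coprime_iff_gcd_eq_1)
  then have "real p \<le> y" "real p > y"
    using assms unfolding smooth_numbers_def rough_numbers_def by blast+
  then show False by simp
qed

lemma smooth_rough_factorization:
  assumes "n \<ge> 1"
  shows "\<exists>a b. a \<in> smooth_numbers y \<and> b \<in> rough_numbers y \<and> n = a * b"
  using assms
proof (induction n rule: less_induct)
  case (less n)
  show ?case
  proof (cases "n = 1")
    case True
    then show ?thesis
      by (intro exI[of _ 1]) (auto simp: smooth_numbers_def rough_numbers_def)
  next
    case False
    then obtain p where p: "prime p" "p dvd n" using prime_factor_nat by blast
    then obtain m where n: "n = p * m" by (elim dvdE)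
    have "m \<ge> 1" "m < n" using less.prems p(1) prime_gt_1_nat[OF p(1)] n by (auto simp: Suc_le_eq)
    then obtain a b where ab: "a \<in> smooth_numbers y" "b \<in> rough_numbers y" "m = a * b"
      using less.IH by blast
    show ?thesis
    proof (cases "real p \<le> y")
      case True
      have "p * a \<in> smooth_numbers y"
        using ab(1) True p(1) prime_gt_0_nat[OF p(1)]
        by (auto simp: smooth_numbers_def prime_dvd_prime_mult)
      with ab n show ?thesis by (intro exI[of _ "p * a"] exI[of _ b]) simp
    next
      case False
      have "p * b \<in> rough_numbers y"
        using ab(2) False p(1) prime_gt_0_nat[OF p(1)]
        by (auto simp: rough_numbers_def prime_dvd_prime_mult)
      with ab n show ?thesis by (intro exI[of _ a] exI[of _ "p * b"]) simp
    qed
  qed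
qed

text \<open>
  Sorting the integers up to \<open>x\<close> by their \<open>y\<close>-smooth part \<open>n\<close>: those with smooth part \<open>n\<close> are the
  products of \<open>n\<close> with the rough numbers up to \<open>x / n\<close>.
\<close>
lemma sum_Phi_eq_floor:
  assumes "x \<ge> 0"
  shows "(\<Sum>n \<in> {n \<in> smooth_numbers y. real n \<le> x}. real (Phi (x / real n) y)) = of_int \<lfloor>x\<rfloor>"
proof -
  let ?S = "{n \<in> smooth_numbers y. real n \<le> x}"
  let ?R = "\<lambda>a. {b \<in> rough_numbers y. real b \<le> x / real a}"
  have pos: "n \<ge> 1" if "n \<in> smooth_numbers y \<union> rough_numbers y" for n
    using that by (auto simp: smooth_numbers_def rough_numbers_def)
  have "bij_betw (\<lambda>(a, b). a * b) (Sigma ?S ?R) {1..nat \<lfloor>x\<rfloor>}"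
  proof (rule bij_betw_imageI)
    show "inj_on (\<lambda>(a, b). a * b) (Sigma ?S ?R)"
    proof (rule inj_onI, clarify)
      fix a b c d
      assume a: "a \<in> smooth_numbers y" and b: "b \<in> rough_numbers y"
        and c: "c \<in> smooth_numbers y" and d: "d \<in> rough_numbers y" and eq: "a * b = c * d"
      have "a dvd c * d" "c dvd a * b" by (simp_all flip: eq) (simp add: eq)
      then have "a dvd c" "c dvd a"
        using coprime_smooth_rough[OF a d] coprime_smooth_rough[OF c b]
        by (simp_all add: coprime_dvd_mult_left_iff)
      then have "a = c" by (rule dvd_antisym)
      then show "a = c \<and> b = d" using eq pos[of a] a by simp
    qed
    have onto: "m \<in> (\<lambda>(a, b). a * b) ` Sigma ?S ?R" if m: "m \<in> {1..nat \<lfloor>x\<rfloor>}" for m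
    proof -
      obtain a b where ab: "a \<in> smooth_numbers y" "b \<in> rough_numbers y" "m = a * b"
        using smooth_rough_factorization[of m y] m by auto
      have ge: "a \<ge> 1" "b \<ge> 1" using pos ab by auto
      have le: "real a * real b \<le> x" using m assms ab(3) by (simp add: le_nat_floor le_nat_iff le_floor_iff)
      have "real a \<le> real a * real b" using ge by simp
      with le have "real a \<le> x" by linarith
      then have "(a, b) \<in> Sigma ?S ?R" using ab ge le by (simp add: le_divide_eq mult.commute)
      then show ?thesis using ab(3) by (intro image_eqI[of _ _ "(a, b)"]) simp_all
    qed
    have into: "(\<lambda>(a, b). a * b) z \<in> {1..nat \<lfloor>x\<rfloor>}" if "z \<in> Sigma ?S ?R" for z
    proof -
      obtain a b where z: "z = (a, b)" by (cases z)
      have ge: "a \<ge> 1" "b \<ge> 1" and "real b \<le> x / real a" using that z pos[of a] pos[of b] by simp_all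
      then have "real (a * b) \<le> x" by (simp add: le_divide_eq mult.commute)
      then show ?thesis using ge z by (simp add: le_nat_floor)
    qed
    show "(\<lambda>(a, b). a * b) ` Sigma ?S ?R = {1..nat \<lfloor>x\<rfloor>}"
      by (intro equalityI image_subsetI subsetI into onto)
  qed
  then have "card (Sigma ?S ?R) = nat \<lfloor>x\<rfloor>" by (simp add: bij_betw_same_card)
  moreover have "card (Sigma ?S ?R) = (\<Sum>n\<in>?S. Phi (x / real n) y)"
  proof (subst card_SigmaI)
    show "(\<Sum>a\<in>?S. card (?R a)) = (\<Sum>n\<in>?S. Phi (x / real n) y)"
      unfolding Phi_def rough_numbers_def by (intro sum.cong arg_cong[where f = card]) auto
  qed (auto intro: finite_nat_le_real)
  ultimately show ?thesis using assms by (simp flip: of_nat_sum)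
qed

section \<open>Inversion of sums over smooth numbers\<close>

text \<open>
  Smooth numbers for an arbitrary set of admissible primes, so that primes can be removed one at
  a time.
\<close>
definition prime_supported :: "nat set \<Rightarrow> nat set" where
  "prime_supported A = {n. n \<ge> 1 \<and> (\<forall>p. prime p \<and> p dvd n \<longrightarrow> p \<in> A)}"

lemma smooth_numbers_eq_prime_supported:
  "smooth_numbers y = prime_supported {p. prime p \<and> real p \<le> y}"
  by (auto simp: smooth_numbers_def prime_supported_def)

text \<open>
  Restricting to \<open>n \<le> x\<close> keeps the sum finite; for \<open>g = Q\<^sup>*\<close> this loses nothing, as \<open>Q\<^sup>*\<close> vanishes
  below \<open>1\<close>.
\<close>
definition dilate_sum :: "(real \<Rightarrow> real) \<Rightarrow> nat set \<Rightarrow> real \<Rightarrow> real" where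
  "dilate_sum g A x = (\<Sum>n \<in> {n \<in> prime_supported A. real n \<le> x}. g (x / real n))"

lemma prime_supported_insert:
  assumes p: "prime p"
  shows "prime_supported (insert p A) = prime_supported A \<union> times p ` prime_supported (insert p A)"
proof -
  have "n \<in> prime_supported A \<union> times p ` prime_supported (insert p A)"
    if n: "n \<in> prime_supported (insert p A)" for n
  proof (cases "p dvd n")
    case True
    then obtain m where "n = p * m" by (elim dvdE)
    moreover from this have "m \<in> prime_supported (insert p A)"
      using n by (auto simp: prime_supported_def Suc_le_eq)
    ultimately show ?thesis by blast
  next
    case False
    then show ?thesis using n by (auto simp: prime_supported_def)
  qed
  moreover have "p * n \<in> prime_supported (insert p A)" if "n \<in> prime_supported (insert p A)" for n
    using that p prime_gt_0_nat[OF p]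
    by (auto simp: prime_supported_def prime_dvd_prime_mult)
  moreover have "prime_supported A \<subseteq> prime_supported (insert p A)"
    by (auto simp: prime_supported_def)
  ultimately show ?thesis by blast
qed

text \<open>
  Split the \<open>n\<close> according to divisibility by the new prime \<open>p\<close>. Solved for the sum over \<open>A\<close>, this
  removes \<open>p\<close> from the set of admissible primes at the price of one additional term at \<open>x / p\<close>.
\<close>
lemma dilate_sum_insert:
  assumes p: "prime p" and A: "p \<notin> A"
  shows "dilate_sum g (insert p A) x = dilate_sum g A x + dilate_sum g (insert p A) (x / real p)"
proof -
  let ?B = "prime_supported (insert p A)"
  have p0: "p > 0" using p by (rule prime_gt_0_nat)
  have "{n \<in> ?B. real n \<le> x}
      = {n \<in> prime_supported A. real n \<le> x} \<union> times p ` {n \<in> ?B. real n \<le> x / real p}"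
    using p0 by (subst prime_supported_insert[OF p]) (auto simp: field_simps)
  moreover have "{n \<in> prime_supported A. real n \<le> x} \<inter> times p ` {n \<in> ?B. real n \<le> x / real p} = {}"
    using p A by (auto simp: prime_supported_def)
  ultimately have "dilate_sum g (insert p A) x = dilate_sum g A x
      + (\<Sum>n \<in> times p ` {n \<in> ?B. real n \<le> x / real p}. g (x / real n))"
    unfolding dilate_sum_def by (simp add: sum.union_disjoint finite_nat_le_real)
  also have "(\<Sum>n \<in> times p ` {n \<in> ?B. real n \<le> x / real p}. g (x / real n))
      = dilate_sum g (insert p A) (x / real p)"
    unfolding dilate_sum_def using p0 by (subst sum.reindex) (auto simp: inj_on_def)
  finally show ?thesis .
qed

text \<open>
  A quantitative Moebius inversion. Removing the prime \<open>p\<close> costs a factor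
  \<open>1 + 1/p \<le> 1 / (1 - 1/p)\<close>, and once no prime is left the sum has the single term \<open>g(x)\<close>.
\<close>
lemma dilate_sum_inversion_bound:
  assumes "finite P" "\<And>p. p \<in> P \<Longrightarrow> prime p"
    and "\<And>x. 0 < x \<Longrightarrow> x \<le> X \<Longrightarrow> \<bar>dilate_sum g P x\<bar> \<le> C * x"
    and x: "1 \<le> x" "x \<le> X" and C: "C \<ge> 0"
  shows "\<bar>g x\<bar> \<le> C * inverse (\<Prod>p\<in>P. 1 - 1 / real p) * x"
proof -
  have "\<bar>dilate_sum g {} x\<bar> \<le> C * inverse (\<Prod>p\<in>P. 1 - 1 / real p) * x"
    using assms(1-3) x(1) x(2) C
  proof (induction P arbitrary: C x rule: finite_induct)
    case empty
    then show ?case by simp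
  next
    case (insert p P)
    have p: "prime p" using insert.prems by simp
    then have p2: "real p \<ge> 2" using prime_ge_2_nat by (metis of_nat_le_iff of_nat_numeral)
    have "\<bar>dilate_sum g P t\<bar> \<le> C * inverse (1 - 1 / real p) * t" if t: "0 < t" "t \<le> X" for t
    proof -
      have "t / real p \<le> t" using t p2 by (simp add: field_simps)
      then have "\<bar>dilate_sum g (insert p P) (t / real p)\<bar> \<le> C * (t / real p)"
        using t p2 by (intro insert.prems) auto
      moreover have "\<bar>dilate_sum g (insert p P) t\<bar> \<le> C * t"
        using t by (intro insert.prems)
      ultimately have "\<bar>dilate_sum g P t\<bar> \<le> C * t + C * (t / real p)"
        using dilate_sum_insert[OF p insert.hyps(2), of g t] by simp
      also have "\<dots> = C * t * (1 + 1 / real p)" by (simp add: field_simps)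
      also have "\<dots> \<le> C * t * inverse (1 - 1 / real p)"
        using insert.prems(5) t p2 by (intro mult_left_mono) (auto simp: field_simps)
      finally show ?thesis by (simp add: mult_ac)
    qed
    moreover have "C * inverse (1 - 1 / real p) \<ge> 0" using insert.prems(5) p2 by simp
    ultimately have "\<bar>dilate_sum g {} x\<bar>
        \<le> C * inverse (1 - 1 / real p) * inverse (\<Prod>p\<in>P. 1 - 1 / real p) * x"
      using insert.prems by (intro insert.IH) auto
    then show ?case using insert.hyps by (simp add: mult_ac)
  qed
  moreover have "{n \<in> prime_supported {}. real n \<le> x} = {1}"
    using x prime_factor_nat by (auto simp: prime_supported_def)
  ultimately show ?thesis by (simp add: dilate_sum_def)
qed

lemma R_star_eq_dilate_sum:
  assumes "x > 0" "y \<ge> 2"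
  shows "R_star x y = dilate_sum (\<lambda>t. Q_star t y) {p. prime p \<and> real p \<le> y} x"
proof -
  have "R_star x y = (\<Sum>\<^sub>\<infinity>n\<in>{n \<in> smooth_numbers y. real n \<le> x}. Q_star (x / real n) y)"
    unfolding R_star_def
  proof (rule infsum_cong_neutral)
    fix n assume "n \<in> smooth_numbers y - {n \<in> smooth_numbers y. real n \<le> x}"
    then have "n \<ge> 1" "real n > x" by (auto simp: smooth_numbers_def)
    then show "Q_star (x / real n) y = 0" using assms by (intro Q_star_less_1) auto
  qed auto
  then show ?thesis
    by (simp add: dilate_sum_def smooth_numbers_eq_prime_supported infsum_finite finite_nat_le_real)
qed

section \<open>The remainder as a convolution\<close>

text \<open>
  From here on \<open>x = y\<^sup>u\<close>, and counting functions of \<open>x\<close> are divided by \<open>x\<close>. In this normalization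
  all of them become elements of the convolution algebra, and replacing \<open>x\<close> by \<open>x / n\<close> becomes a
  translation in \<open>u\<close> combined with the factor \<open>1 / n\<close>.
\<close>
definition exp_decay :: "real \<Rightarrow> real \<Rightarrow> real" where
  "exp_decay y v = unit_step v * y powr (- v)"

lemma causal_exp_decay:
  assumes "y > 0"
  shows "causal (exp_decay y)"
proof (rule causal_continuous_on)
  have "continuous_on {0..} (\<lambda>v. y powr (- v))" using assms by (intro continuous_intros) auto
  then show "continuous_on {0..} (exp_decay y)"
    by (rule continuous_on_eq) (simp add: exp_decay_def)
qed (auto simp: exp_decay_def)

lemma mu_eq_conv:
  assumes "y > 0"
  shows "mu y = buchstab \<star> exp_decay y"
proof
  fix u
  have "(buchstab \<star> exp_decay y) u = integral {0..u} (\<lambda>v. exp_decay y v * buchstab (u - v))"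
    by (subst conv_commute) (rule conv_eq_integral[OF causal_exp_decay[OF assms] causal_buchstab])
  also have "\<dots> = mu y u"
    unfolding mu_def by (rule integral_cong) (simp add: exp_decay_def)
  finally show "mu y u = (buchstab \<star> exp_decay y) u" by simp
qed

definition frac_decay :: "real \<Rightarrow> real \<Rightarrow> real" where
  "frac_decay y v = frac (y powr v) * exp_decay y v"

lemma causal_frac_decay:
  assumes "y > 0"
  shows "causal (frac_decay y)"
  unfolding frac_decay_def
proof (rule causal_mult_bounded[OF causal_exp_decay[OF assms]])
  show "(\<lambda>v. frac (y powr v)) \<in> borel_measurable borel"
    unfolding frac_def by measurable
  show "\<exists>B. \<forall>u\<in>{0..T}. \<bar>frac (y powr u)\<bar> \<le> B" for T
    by (intro exI[of _ 1]) (simp add: less_imp_le[OF frac_lt_1])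
qed

definition normalized_Lambda :: "real \<Rightarrow> real \<Rightarrow> real" where
  "normalized_Lambda y u = dickman u - frac_decay y u - (frac_decay y \<star> dickman_deriv) u"

lemma causal_normalized_Lambda:
  assumes "y > 0"
  shows "causal (normalized_Lambda y)"
  unfolding normalized_Lambda_def[abs_def]
  by (intro causal_diff causal_conv causal_dickman causal_dickman_deriv causal_frac_decay assms)

lemma Lambda_eq:
  assumes y: "y > 1" and u: "u \<ge> 0"
  shows "Lambda (y powr u) y = y powr u * normalized_Lambda y u"
proof -
  have "(frac_decay y \<star> dickman_deriv) u
      = integral {0..u} (\<lambda>v. dickman_deriv (u - v) * (frac (y powr v) / y powr v))"
    unfolding conv_eq_integral[OF causal_frac_decay causal_dickman_deriv] using y
    by (subst conv_eq_integral[OF causal_frac_decay causal_dickman_deriv])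
       (auto intro!: integral_cong simp: frac_decay_def exp_decay_def powr_minus field_simps)
  moreover have "ln (y powr u) / ln y = u" using y by (simp add: ln_powr)
  moreover have "y powr u * frac_decay y u = frac (y powr u)"
    using y u by (simp add: frac_decay_def exp_decay_def powr_minus field_simps)
  ultimately show ?thesis
    by (simp add: Lambda_def normalized_Lambda_def Let_def right_diff_distrib)
qed

definition normalized_Psi :: "real \<Rightarrow> real \<Rightarrow> real" where
  "normalized_Psi y u = real (Psi (y powr u) y) * y powr (- u)"

text \<open>
  The translate by \<open>log n / log y\<close> is, up to the factor \<open>n\<close>, the contribution of the integer \<open>n\<close> to a
  normalized counting function.
\<close>
lemma exp_decay_shift:
  assumes y: "y > 1" and n: "n \<ge> 1"
  shows "exp_decay y (v - ln (real n) / ln y) = (if real n \<le> y powr v then real n * y powr (- v) else 0)"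
proof -
  let ?l = "ln (real n) / ln y"
  have n_eq: "y powr ?l = real n" using y n by (simp add: powr_def)
  have "real n \<le> y powr v \<longleftrightarrow> ?l \<le> v"
    by (subst n_eq[symmetric]) (use y in \<open>simp add: powr_le_cancel_iff\<close>)
  moreover have "y powr (- (v - ?l)) = y powr ?l * y powr (- v)"
    by (simp flip: powr_add)
  ultimately show ?thesis by (auto simp: exp_decay_def n_eq split: split_indicator)
qed

text \<open>
  The summation runs up to \<open>y\<^sup>u\<close> for all \<open>v \<le> u\<close> simultaneously, so that the finite sum can be taken
  out of a convolution evaluated at \<open>u\<close>.
\<close>
lemma normalized_Psi_eq_sum:
  assumes y: "y > 1" and v: "v \<le> u"
  shows "normalized_Psi y v = (\<Sum>n \<in> {n \<in> smooth_numbers y. real n \<le> y powr u}.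
           1 / real n * exp_decay y (v - ln (real n) / ln y))"
proof -
  let ?N = "\<lambda>u. {n \<in> smooth_numbers y. real n \<le> y powr u}"
  have mono: "y powr v \<le> y powr u" using y v by simp
  have ge: "n \<ge> 1" if "n \<in> smooth_numbers y" for n using that by (simp add: smooth_numbers_def)
  have "normalized_Psi y v = (\<Sum>n\<in>?N v. y powr (- v))"
    by (simp add: normalized_Psi_def Psi_def)
  also have "\<dots> = (\<Sum>n\<in>?N u. if real n \<le> y powr v then y powr (- v) else 0)"
    using mono by (intro sum.mono_neutral_cong_left) (auto intro: finite_nat_le_real)
  also have "\<dots> = (\<Sum>n\<in>?N u. 1 / real n * exp_decay y (v - ln (real n) / ln y))"
    using ge by (intro sum.cong) (simp_all add: exp_decay_shift[OF y] Suc_le_eq)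
  finally show ?thesis .
qed

text \<open>
  Convolving each translate of \<open>y\<^sup>-\<^sup>v\<close> with \<open>\<omega>\<close> gives the same translate of \<open>\<mu>\<^sub>y\<close>, so the main terms
  of \<open>V\<^sup>*(x/n, y)\<close> sum up to a single convolution.
\<close>
lemma buchstab_conv_normalized_Psi:
  assumes y: "y > 1"
  shows "(buchstab \<star> normalized_Psi y) u
    = (\<Sum>n \<in> {n \<in> smooth_numbers y. real n \<le> y powr u}. 1 / real n * mu y (u - ln (real n) / ln y))"
proof -
  let ?N = "{n \<in> smooth_numbers y. real n \<le> y powr u}"
  have causal: "causal (\<lambda>v. 1 / real n * exp_decay y (v - ln (real n) / ln y))" if "n \<in> ?N" for n
    using that y by (intro causal_cmult causal_shift causal_exp_decay) (auto simp: smooth_numbers_def)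
  have "(buchstab \<star> normalized_Psi y) u
      = (buchstab \<star> (\<lambda>v. \<Sum>n\<in>?N. 1 / real n * exp_decay y (v - ln (real n) / ln y))) u"
    by (rule conv_cong[OF causal_buchstab normalized_Psi_eq_sum[OF y]])
  also have "\<dots> = (\<Sum>n\<in>?N. (buchstab \<star> (\<lambda>v. 1 / real n * exp_decay y (v - ln (real n) / ln y))) u)"
    by (rule conv_sum_right[OF causal_buchstab causal])
  also have "\<dots> = (\<Sum>n\<in>?N. 1 / real n * mu y (u - ln (real n) / ln y))"
    unfolding conv_cmult_right conv_shift_right using y by (simp add: mu_eq_conv)
  finally show ?thesis .
qed

lemma causal_normalized_Psi:
  assumes y: "y > 1"
  shows "causal (normalized_Psi y)"
proof (rule causalI)
  have ge: "n \<ge> 1" if "n \<in> smooth_numbers y" for n using that by (simp add: smooth_numbers_def)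
  have "mono (\<lambda>u. real (Psi (y powr u) y))"
  proof (rule monoI)
    fix a b :: real assume "a \<le> b"
    then have "y powr a \<le> y powr b" using y by simp
    then show "real (Psi (y powr a) y) \<le> real (Psi (y powr b) y)"
      unfolding Psi_def by (auto intro!: card_mono finite_nat_le_real)
  qed
  then have [measurable]: "(\<lambda>u. real (Psi (y powr u) y)) \<in> borel_measurable borel"
    by (rule borel_measurable_mono)
  show "normalized_Psi y \<in> borel_measurable borel"
    unfolding normalized_Psi_def[abs_def] by measurable
  show "normalized_Psi y u = 0" if "u < 0" for u
  proof -
    have "y powr u < 1" using powr_less_cancel_iff[OF y, of u 0] y that by simp
    then have no_terms: "{n \<in> smooth_numbers y. real n \<le> y powr u} = {}" by (auto dest: ge)
    show ?thesis unfolding normalized_Psi_def Psi_def no_terms by simp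
  qed
  fix T :: real
  let ?N = "{n \<in> smooth_numbers y. real n \<le> y powr T}"
  have "\<bar>normalized_Psi y u\<bar> \<le> real (card ?N)" if u: "u \<in> {0..T}" for u
  proof -
    have "y powr u \<le> y powr T" "y powr (- u) \<le> 1" using y u by (auto simp: powr_le_one_le powr_minus inverse_le_1_iff ge_one_powr_ge_zero)
    then have "real (Psi (y powr u) y) * y powr (- u) \<le> real (card ?N) * 1"
      unfolding Psi_def by (intro mult_mono) (auto intro!: card_mono finite_nat_le_real)
    then show ?thesis by (simp add: normalized_Psi_def)
  qed
  then show "\<exists>B. \<forall>u\<in>{0..T}. \<bar>normalized_Psi y u\<bar> \<le> B" by blast
qed

definition normalized_Delta :: "real \<Rightarrow> real \<Rightarrow> real" where
  "normalized_Delta y u = normalized_Psi y u - normalized_Lambda y u"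

lemma causal_normalized_Delta: "y > 1 \<Longrightarrow> causal (normalized_Delta y)"
  unfolding normalized_Delta_def[abs_def]
  by (intro causal_diff causal_normalized_Psi causal_normalized_Lambda) auto

lemma Delta_eq:
  assumes "y > 1" "u \<ge> 0"
  shows "Delta (y powr u) y = y powr u * normalized_Delta y u"
  using assms Lambda_eq[OF assms]
  by (simp add: Delta_def normalized_Delta_def normalized_Psi_def right_diff_distrib powr_minus)

text \<open>
  Summing \<open>V\<^sup>* - \<Phi>\<close> over smooth \<open>n\<close> gives \<open>\<Psi>\<close> from the constant term, \<open>\<omega> \<star> \<Psi>\<close> from the main term,
  and \<open>\<lfloor>x\<rfloor>\<close> from \<open>\<Phi>\<close>. As \<open>\<Lambda>\<close> solves \<open>\<Lambda> + \<omega> \<star> \<Lambda> = \<lfloor>x\<rfloor>\<close> (all normalized by \<open>x\<close>), only \<open>\<Delta> = \<Psi> - \<Lambda>\<close>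
  survives.
\<close>
lemma R_star_eq_conv:
  assumes y: "y \<ge> 2" and u: "u \<ge> 0"
  shows "R_star (y powr u) y = y powr u * (normalized_Delta y u + (buchstab \<star> normalized_Delta y) u)"
proof -
  let ?x = "y powr u" and ?N = "{n \<in> smooth_numbers y. real n \<le> y powr u}"
  have y1: "y > 1" using y by simp
  have x: "?x > 0" using y1 by simp
  have ge: "n \<ge> 1" if "n \<in> ?N" for n using that by (simp add: smooth_numbers_def)
  have "R_star ?x y = (\<Sum>n\<in>?N. Q_star (?x / real n) y)"
    using R_star_eq_dilate_sum[OF x y] by (simp add: dilate_sum_def smooth_numbers_eq_prime_supported)
  also have "\<dots> = (\<Sum>n\<in>?N. 1 + ?x * (1 / real n * mu y (u - ln (real n) / ln y)) - real (Phi (?x / real n) y))"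
  proof (rule sum.cong)
    fix n assume n: "n \<in> ?N"
    have "ln (?x / real n) / ln y = u - ln (real n) / ln y"
      using y1 ge[OF n] by (simp add: ln_div ln_powr diff_divide_distrib)
    then show "Q_star (?x / real n) y
        = 1 + ?x * (1 / real n * mu y (u - ln (real n) / ln y)) - real (Phi (?x / real n) y)"
      using n ge[OF n] by (simp add: Q_star_def V_star_def le_divide_eq)
  qed simp
  also have "\<dots> = real (card ?N) + ?x * (buchstab \<star> normalized_Psi y) u - of_int \<lfloor>?x\<rfloor>"
    using sum_Phi_eq_floor[of ?x y] x
    by (simp add: sum.distrib sum_subtractf buchstab_conv_normalized_Psi[OF y1] sum_distrib_left)
  also have "real (card ?N) = ?x * normalized_Psi y u"
    using x by (simp add: normalized_Psi_def Psi_def powr_minus)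
  also have "of_int \<lfloor>?x\<rfloor> = ?x * (unit_step u - frac_decay y u)"
    using x u by (simp add: frac_decay_def exp_decay_def powr_minus frac_def field_simps)
  also have "unit_step u - frac_decay y u = normalized_Lambda y u + (buchstab \<star> normalized_Lambda y) u"
    using normalized_Lambda_identity[OF causal_frac_decay, of y u] y1
    by (simp add: normalized_Lambda_def[abs_def])
  also have "?x * normalized_Psi y u + ?x * (buchstab \<star> normalized_Psi y) u
        - ?x * (normalized_Lambda y u + (buchstab \<star> normalized_Lambda y) u)
      = ?x * (normalized_Delta y u + (buchstab \<star> normalized_Delta y) u)"
    using y1 unfolding normalized_Delta_def[abs_def]
    by (simp add: conv_diff_right causal_buchstab causal_normalized_Psi causal_normalized_Lambda algebra_simps)
  finally show ?thesis .
qed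

text \<open>
  Because \<open>\<omega> \<ge> 0\<close>, the bound on \<open>\<Delta>\<close> may be inserted into \<open>\<Delta> + \<omega> \<star> \<Delta>\<close>, and
  \<open>\<rho> + \<omega> \<star> \<rho> = 1\<close> evaluates the resulting majorant exactly.
\<close>
lemma abs_R_star_le:
  assumes y: "y \<ge> 2" and x: "1 \<le> x"
    and \<Delta>: "\<And>t. 1 \<le> t \<Longrightarrow> t \<le> x \<Longrightarrow> \<bar>Delta t y\<bar> \<le> t * c * dickman (ln t / ln y)"
  shows "\<bar>R_star x y\<bar> \<le> x * c"
proof -
  define u where "u = ln x / ln y"
  have y1: "y > 1" using y by simp
  have u: "u \<ge> 0" and xu: "x = y powr u" using x y1 by (auto simp: u_def powr_def)
  have le: "\<bar>normalized_Delta y v\<bar> \<le> c * dickman v" if v: "v \<le> u" for v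
  proof (cases "v < 0")
    case True
    then show ?thesis using y1 by (simp add: causal_neg[OF causal_normalized_Delta] dickman_neg)
  next
    case False
    have "y powr v * \<bar>normalized_Delta y v\<bar> = \<bar>Delta (y powr v) y\<bar>"
      using Delta_eq[OF y1, of v] False by (simp add: abs_mult)
    also have "\<dots> \<le> y powr v * c * dickman (ln (y powr v) / ln y)"
      using False v y1 by (intro \<Delta>) (auto simp: xu ge_one_powr_ge_zero)
    also have "\<dots> = y powr v * (c * dickman v)" using y1 by (simp add: ln_powr)
    finally show ?thesis using y1 by (simp add: mult_le_cancel_left)
  qed
  have "\<bar>(buchstab \<star> normalized_Delta y) u\<bar> \<le> (buchstab \<star> (\<lambda>v. c * dickman v)) u"
    using le y1 by (intro conv_mono causal_buchstab causal_normalized_Delta causal_cmult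
        causal_dickman buchstab_nonneg) auto
  then have "\<bar>normalized_Delta y u + (buchstab \<star> normalized_Delta y) u\<bar>
      \<le> c * (dickman u + (buchstab \<star> dickman) u)"
    using le[of u] by (simp add: conv_cmult_right distrib_left)
  then have "\<bar>normalized_Delta y u + (buchstab \<star> normalized_Delta y) u\<bar> \<le> c"
    using u by (simp add: dickman_plus_buchstab_conv_dickman)
  then show ?thesis
    unfolding xu R_star_eq_conv[OF y u] using y1 by (simp add: abs_mult)
qed

section \<open>The bounds\<close>

theorem corollary3:
  fixes X y :: real and f :: "real \<Rightarrow> real"
  assumes "X \<ge> 1" and "y \<ge> 2" and "f y > 0"
    and "\<forall>x. 1 \<le> x \<and> x \<le> X \<longrightarrow> \<bar>Delta x y\<bar> \<le> x * f y * dickman (ln x / ln y)"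
  shows "(\<forall>x. 1 \<le> x \<and> x \<le> X \<longrightarrow> \<bar>R_star x y\<bar> \<le> x * f y) \<and>
         (\<forall>x. 1 \<le> x \<and> x \<le> X \<longrightarrow> \<bar>Q_star x y\<bar> \<le> x * f y * inverse (prime_prod y))"
proof -
  have R: "\<bar>R_star x y\<bar> \<le> x * f y" if "1 \<le> x" "x \<le> X" for x
    using assms that by (intro abs_R_star_le) auto
  let ?P = "{p. prime p \<and> real p \<le> y}"
  have "\<bar>Q_star x y\<bar> \<le> x * f y * inverse (prime_prod y)" if x: "1 \<le> x" "x \<le> X" for x
  proof -
    have "\<bar>dilate_sum (\<lambda>t. Q_star t y) ?P t\<bar> \<le> f y * t" if t: "0 < t" "t \<le> X" for t
    \<comment> \<open>The inversion visits all \<open>x / d\<close>; those below \<open>1\<close> lie outside the hypothesis but give empty sums.\<close>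
    proof (cases "t < 1")
      case True
      have no_terms: "{n \<in> prime_supported ?P. real n \<le> t} = {}"
        using True by (auto simp: prime_supported_def)
      show ?thesis unfolding dilate_sum_def no_terms using t assms(3) by simp
    next
      case False
      then show ?thesis
        using R[of t] R_star_eq_dilate_sum[OF t(1) assms(2)] t by (simp add: mult.commute)
    qed
    then have "\<bar>Q_star x y\<bar> \<le> f y * inverse (\<Prod>p\<in>?P. 1 - 1 / real p) * x"
      using x assms by (intro dilate_sum_inversion_bound) (auto intro: finite_nat_le_real)
    then show ?thesis by (simp add: prime_prod_def mult_ac)
  qed
  with R show ?thesis by blast
qed

end
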